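(* Let $(X,d)$ be a metric space, let $T:X\to X$ be a self-mapping, let $\varphi:X\to[0,\infty)$ be a given function, and let $\rho:=\inf\{d(Tx,x): x\in X,\ x\neq Tx\}$. Let $x_0\in X$ and suppose that $T$ is a type $3$ $\varphi_{x_0}$-contraction with the point $x_0$ and the function $\varphi$. If $\varphi(x_0)=0$ and $\varphi(x)\leq d(Tx,x)$ for all $x\in D_{x_0,\rho}$, then the disc $D_{x_0,\rho}$ is a $\varphi$-fixed disc of $T$.
   Context: Notation: $Fix(T)=\{x\in X: Tx=x\}$, $Z_\varphi=\{x\in X:\varphi(x)=0\}$, and $D_{x_0,r}=\{x\in X: d(x,x_0)\leq r\}$. A disc $D_{x_0,r}$ is a $\varphi$-fixed disc of $T$ if and only if $D_{x_0,r}\subseteq Fix(T)\cap Z_\varphi$. $T$ is a type $3$ $\varphi_{x_0}$-contraction if there is some $k\in(0,1)$ such that, for all $x\in X$, $d(Tx,x)>0$ implies $d(x,Tx)+\varphi(Tx)+\varphi(x)\leq k\left[d(x,x_0)+\varphi(x)+\varphi(x_0)\right]$. *)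

theory Defs
  imports "HOL-Analysis.Analysis"
begin

definition Fix :: "('a \<Rightarrow> 'a) \<Rightarrow> 'a set" where
  "Fix T = {x. T x = x}"

definition zero_set :: "('a \<Rightarrow> real) \<Rightarrow> 'a set" where
  "zero_set \<phi> = {x. \<phi> x = 0}"

(* The radius is extended real because the infimum rho below is \<infinity>, by the usual convention
   on the infimum of the empty set, when T is the identity. The disc of radius \<infinity> is the
   whole space. *)
definition disc :: "'a::metric_space \<Rightarrow> ereal \<Rightarrow> 'a set" where
  "disc x0 r = {x. ereal (dist x x0) \<le> r}"

lemma disc_ereal: "disc x0 (ereal r) = cball x0 r"
  by (auto simp: disc_def dist_commute)

definition phi_fixed_disc :: "('a \<Rightarrow> real) \<Rightarrow> ('a \<Rightarrow> 'a) \<Rightarrow> 'a::metric_space \<Rightarrow> ereal \<Rightarrow> bool" where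
  "phi_fixed_disc \<phi> T x0 r \<longleftrightarrow> disc x0 r \<subseteq> Fix T \<inter> zero_set \<phi>"

definition type3_phi_contraction ::
    "('a \<Rightarrow> real) \<Rightarrow> 'a \<Rightarrow> ('a::metric_space \<Rightarrow> 'a) \<Rightarrow> bool" where
  "type3_phi_contraction \<phi> x0 T \<longleftrightarrow>
     (\<exists>k\<in>{0<..<1}. \<forall>x. dist (T x) x > 0 \<longrightarrow>
        dist x (T x) + \<phi> (T x) + \<phi> x \<le> k * (dist x x0 + \<phi> x + \<phi> x0))"

definition rho :: "('a::metric_space \<Rightarrow> 'a) \<Rightarrow> ereal" where
  "rho T = Inf {ereal (dist (T x) x) | x. x \<noteq> T x}"

lemma rho_eq_real_Inf:
  assumes "\<exists>x. x \<noteq> T x"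
  shows "rho T = ereal (Inf {dist (T x) x | x. x \<noteq> T x})"
proof -
  let ?S = "{dist (T x) x | x. x \<noteq> T x}"
  have b: "bdd_below ?S" by (rule bdd_belowI[of _ 0]) auto
  have ne: "?S \<noteq> {}" using assms by auto
  have e: "{ereal (dist (T x) x) | x. x \<noteq> T x} = ereal ` ?S" by auto
  have "\<bar>Inf (ereal ` ?S)\<bar> \<noteq> \<infinity>"
  proof -
    obtain s where s: "s \<in> ?S" using ne by blast
    have "0 \<le> Inf (ereal ` ?S)" by (rule Inf_greatest) auto
    moreover have "Inf (ereal ` ?S) \<le> ereal s" by (rule Inf_lower) (use s in blast)
    ultimately show ?thesis by auto
  qed
  then show ?thesis unfolding rho_def e by (simp add: ereal_Inf)
qed

end

theory Submission
  imports Defs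
begin

text \<open>A point \<open>x\<close> of the disc with \<open>T x \<noteq> x\<close> is displaced by
  at least \<open>rho T\<close>, hence by at least its distance to \<open>x0\<close>. As
  \<open>\<phi> x0 = 0\<close>, the bracket in the contraction condition is then at most
  \<open>dist (T x) x + \<phi> x\<close>, while the left side is at least this positive quantity;
  the factor \<open>k < 1\<close> makes that absurd.\<close>

theorem theorem2p10:
  fixes T :: "'a::metric_space \<Rightarrow> 'a" and \<phi> :: "'a \<Rightarrow> real" and x0 :: 'a
  assumes "\<And>x. 0 \<le> \<phi> x"
    and "type3_phi_contraction \<phi> x0 T"
    and "\<phi> x0 = 0"
    and "\<And>x. x \<in> disc x0 (rho T) \<Longrightarrow> \<phi> x \<le> dist (T x) x"
  shows "phi_fixed_disc \<phi> T x0 (rho T)"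
proof -
  obtain k where k: "0 < k" "k < 1"
    and contr: "\<And>x. dist (T x) x > 0 \<Longrightarrow>
      dist x (T x) + \<phi> (T x) + \<phi> x \<le> k * (dist x x0 + \<phi> x + \<phi> x0)"
    using assms(2) unfolding type3_phi_contraction_def by auto
  have "T x = x \<and> \<phi> x = 0" if x: "x \<in> disc x0 (rho T)" for x
  proof -
    have fixed: "T x = x"
    proof (rule ccontr)
      assume moved: "T x \<noteq> x"
      \<comment> \<open>\<open>s\<close> separates the two sides of the contraction inequality: it
        bounds the left side from below and the bracket on the right from above.\<close>
      define s where "s = dist (T x) x + \<phi> x"
      have "rho T \<le> ereal (dist (T x) x)"
        unfolding rho_def by (rule Inf_lower) (use moved in auto)
      with x have "ereal (dist x x0) \<le> ereal (dist (T x) x)"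
        unfolding disc_def by (blast intro: order_trans)
      then have near: "dist x x0 + \<phi> x + \<phi> x0 \<le> s"
        using assms(3) by (simp add: s_def)
      have "s \<le> dist x (T x) + \<phi> (T x) + \<phi> x"
        using assms(1)[of "T x"] by (simp add: s_def dist_commute)
      also have "\<dots> \<le> k * (dist x x0 + \<phi> x + \<phi> x0)"
        using contr[of x] moved by simp
      also have "\<dots> \<le> k * s"
        using near k(1) by (simp add: mult_left_mono)
      finally have "s \<le> k * s" .
      moreover have "0 < s"
        using moved assms(1)[of x] by (simp add: s_def add_pos_nonneg)
      ultimately show False
        using k(2) by simp
    qed
    \<comment> \<open>At a fixed point the bound on \<open>\<phi> x\<close> by the displacement
      becomes \<open>\<phi> x \<le> 0\<close>.\<close>
    with assms(1)[of x] assms(4)[OF x] show ?thesis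
      by simp
  qed
  then show ?thesis
    unfolding phi_fixed_disc_def Fix_def zero_set_def by blast
qed

end
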